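(* Let $\star$ be a semistar operation on an integral domain $D$. The following are equivalent: (i) $D$ is an $H(\star)$-domain; (ii) for each nonzero fractional ideal $I$ of $D$, $I$ is $\star$-invertible if and only if $I$ is $\star_f$-invertible; (iii) $\mathcal{M}(\star_f)=\mathcal{M}(\star)$; (iv) $\mathcal{M}(\widetilde{\star})=\mathcal{M}(\star)$.
   Context: Let $D$ be an integral domain with quotient field $K$; $\overline{F}(D)$ is the set of nonzero $D$-submodules of $K$. A semistar operation on $D$ is a map $\star:\overline{F}(D)\to\overline{F}(D)$, $E\mapsto E^\star$, such that for all $0\ne x\in K$ and $E,F\in\overline{F}(D)$: $(xE)^\star=xE^\star$; $E\subseteq F$ implies $E^\star\subseteq F^\star$; $E\subseteq E^\star$ and $(E^\star)^\star=E^\star$. The semistar operation of finite type associated to $\star$ is $\star_f$, defined by $E^{\star_f}=\bigcup\{F^\star : F\subseteq E,\ F \text{ a nonzero finitely generated } D\text{-submodule of } K\}$. For any semistar operation $\star$, a nonzero ideal $I\subseteq D$ is a quasi-$\star$-ideal if $I^\star\cap D=I$, and $\mathcal{M}(\star)$ denotes the set of quasi-$\star$-maximal ideals, i.e. the maximal elements of the set of proper quasi-$\star$-ideals of $D$. The elements of $\mathcal{M}(\star_f)$ are prime ideals. The semistar operation $\widetilde{\star}$ is defined by $E^{\widetilde{\star}}=\bigcap\{ED_Q : Q\in\mathcal{M}(\star_f)\}$ (an empty intersection being $K$). For $E,F\in\overline{F}(D)$, $(E:F)=\{z\in K: zF\subseteq E\}$, and $I^{-1}=(D:I)$. For a semistar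 operation $\ast$, a nonzero fractional ideal $I$ of $D$ is $\ast$-invertible if $(II^{-1})^{\ast}=D^{\ast}$. $D$ is an $H(\star)$-domain if for each nonzero integral ideal $I$ of $D$ with $I^\star=D^\star$ there exists a nonzero finitely generated ideal $J\subseteq I$ with $J^\star=D^\star$. *)

theory Defs
  imports "HOL-Computational_Algebra.Polynomial_Factorial"
begin

text \<open>
  The integral domain is the type \<open>'a :: idom\<close> and its quotient field is the library's
  \<open>'a fract\<close>. Everything lives inside the quotient field: \<open>D\<close> is identified with its image
  \<open>dom_set\<close>, and ideals of \<open>D\<close> are subsets of that image.
\<close>

definition dom_set :: "'a::idom fract set" where
  "dom_set = range to_fract"

definition fscale :: "'a::idom \<Rightarrow> 'a fract \<Rightarrow> 'a fract" where
  "fscale d x = to_fract d * x"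

global_interpretation fract: module "fscale :: 'a::idom \<Rightarrow> 'a fract \<Rightarrow> 'a fract"
  by unfold_locales (simp_all add: fscale_def algebra_simps)

text \<open>\<open>fract.subspace\<close> is the predicate ``\<open>D\<close>-submodule of \<open>K\<close>''.\<close>

definition Fbar :: "'a::idom fract set set" where
  "Fbar = {E. fract.subspace E \<and> E \<noteq> {0}}"

definition fin_gen :: "'a::idom fract set \<Rightarrow> bool" where
  "fin_gen E \<longleftrightarrow> (\<exists>S. finite S \<and> E = fract.span S)"

definition nz_ideal :: "'a::idom fract set \<Rightarrow> bool" where
  "nz_ideal I \<longleftrightarrow> I \<in> Fbar \<and> I \<subseteq> dom_set"

definition nz_fractional_ideal :: "'a::idom fract set \<Rightarrow> bool" where
  "nz_fractional_ideal I \<longleftrightarrow> I \<in> Fbar \<and> (\<exists>d. d \<noteq> 0 \<and> fscale d ` I \<subseteq> dom_set)"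

definition mod_mult :: "'a::idom fract set \<Rightarrow> 'a fract set \<Rightarrow> 'a fract set" where
  "mod_mult E F = fract.span {x * y | x y. x \<in> E \<and> y \<in> F}"

definition colon :: "'a::idom fract set \<Rightarrow> 'a fract set \<Rightarrow> 'a fract set" where
  "colon E F = {z. (*) z ` F \<subseteq> E}"

definition localization :: "'a::idom fract set \<Rightarrow> 'a fract set" where
  "localization Q = {a / s | a s. a \<in> dom_set \<and> s \<in> dom_set - Q}"

text \<open>
  A semistar operation is only constrained on \<open>Fbar\<close>; the values of the total function
  outside \<open>Fbar\<close> are irrelevant.
\<close>

definition semistar :: "('a::idom fract set \<Rightarrow> 'a fract set) \<Rightarrow> bool" where
  "semistar st \<longleftrightarrow>
     (\<forall>E\<in>Fbar. st E \<in> Fbar) \<and>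
     (\<forall>E\<in>Fbar. \<forall>x. x \<noteq> 0 \<longrightarrow> st ((*) x ` E) = (*) x ` st E) \<and>
     (\<forall>E\<in>Fbar. \<forall>F\<in>Fbar. E \<subseteq> F \<longrightarrow> st E \<subseteq> st F) \<and>
     (\<forall>E\<in>Fbar. E \<subseteq> st E \<and> st (st E) = st E)"

definition star_f ::
    "('a::idom fract set \<Rightarrow> 'a fract set) \<Rightarrow> 'a fract set \<Rightarrow> 'a fract set" where
  "star_f st E = \<Union>{st F | F. F \<in> Fbar \<and> fin_gen F \<and> F \<subseteq> E}"

definition quasi_star_ideal ::
    "('a::idom fract set \<Rightarrow> 'a fract set) \<Rightarrow> 'a fract set \<Rightarrow> bool" where
  "quasi_star_ideal st I \<longleftrightarrow> nz_ideal I \<and> st I \<inter> dom_set = I"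

definition quasi_star_max ::
    "('a::idom fract set \<Rightarrow> 'a fract set) \<Rightarrow> 'a fract set set" where
  "quasi_star_max st =
     {M. quasi_star_ideal st M \<and> M \<noteq> dom_set \<and>
         (\<forall>J. quasi_star_ideal st J \<and> J \<noteq> dom_set \<and> M \<subseteq> J \<longrightarrow> J = M)}"

text \<open>The empty intersection below is \<open>UNIV\<close>, i.e. the whole quotient field.\<close>

definition star_tilde ::
    "('a::idom fract set \<Rightarrow> 'a fract set) \<Rightarrow> 'a fract set \<Rightarrow> 'a fract set" where
  "star_tilde st E = (\<Inter>Q\<in>quasi_star_max (star_f st). mod_mult E (localization Q))"

definition star_invertible ::
    "('a::idom fract set \<Rightarrow> 'a fract set) \<Rightarrow> 'a fract set \<Rightarrow> bool" where
  "star_invertible st I \<longleftrightarrow> st (mod_mult I (colon dom_set I)) = st dom_set"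

definition H_domain :: "('a::idom fract set \<Rightarrow> 'a fract set) \<Rightarrow> bool" where
  "H_domain st \<longleftrightarrow>
     (\<forall>I. nz_ideal I \<and> st I = st dom_set \<longrightarrow>
        (\<exists>J. nz_ideal J \<and> fin_gen J \<and> J \<subseteq> I \<and> st J = st dom_set))"

end

theory Submission
  imports Defs
begin

text \<open>
  All four conditions say that \<open>\<star>\<close> and \<open>\<star>\<^sub>f\<close> agree about which ideals of \<open>D\<close> are
  \<^emph>\<open>dense\<close>, that is, have \<open>1\<close> in their closure. For an ideal \<open>I\<close> the equation
  \<open>I\<^sup>\<star> = D\<^sup>\<star>\<close> means \<open>1 \<in> I\<^sup>\<star>\<close>, and a finitely generated \<open>J \<subseteq> I\<close> with \<open>J\<^sup>\<star> = D\<^sup>\<star>\<close>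
  exists exactly when \<open>1 \<in> I\<^bsup>\<star>f\<^esup>\<close>. So \<open>D\<close> is an \<open>H(\<star>)\<close>-domain iff every \<open>\<star>\<close>-dense ideal
  is \<open>\<star>\<^sub>f\<close>-dense (\<open>H_domain_iff_dense\<close>). Since \<open>\<star>\<^sub>f\<close> is itself a semistar operation
  (\<open>semistar_star_f\<close>), everything proved for \<open>\<star>\<close> also holds for \<open>\<star>\<^sub>f\<close>.

  Invertibility of \<open>I\<close> is density of the ideal \<open>I I\<^sup>-\<^sup>1\<close>, so the \<open>H(\<star>)\<close>-property makes the two
  notions of invertibility agree. For the converse, let \<open>I\<close> be \<open>\<star>\<close>-dense. It is then
  \<open>\<star>\<close>-invertible, as \<open>I \<subseteq> I I\<^sup>-\<^sup>1\<close>, hence \<open>\<star>\<^sub>f\<close>-invertible; and density of \<open>I\<close> forces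
  \<open>I\<^sup>-\<^sup>1 \<subseteq> D\<^sup>\<star>\<close>, which gives \<open>I I\<^sup>-\<^sup>1 \<subseteq> I\<^bsup>\<star>f\<^esup>\<close>, so that \<open>\<star>\<^sub>f\<close>-density of \<open>I I\<^sup>-\<^sup>1\<close> passes
  to \<open>I\<close> (\<open>dense_inverse_product\<close>).

  For the maximal spectra, Zorn's lemma puts every ideal that is not \<open>\<star>\<^sub>f\<close>-dense below some
  quasi-\<open>\<star>\<^sub>f\<close>-maximal ideal (\<open>exists_quasi_star_f_max\<close>). The quasi-\<open>\<star>\<^sub>f\<close>-maximal ideals thus
  detect \<open>\<star>\<^sub>f\<close>-density, and equality of the spectra amounts to equality of the dense ideals.
  Finally \<open>\<M>(\<star>~) = \<M>(\<star>\<^sub>f)\<close> holds for every \<open>\<star>\<close>, because quasi-\<open>\<star>\<^sub>f\<close>-maximal ideals \<open>Q\<close>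
  are prime and so satisfy \<open>Q D\<^sub>Q \<inter> D = Q\<close>; the last condition is therefore the third one
  in another form.
\<close>

section \<open>Submodules of the quotient field\<close>

lemma dom_setI: "to_fract d \<in> dom_set"
  by (simp add: dom_set_def)

lemma one_in_dom_set: "1 \<in> dom_set"
  by (metis dom_setI to_fract_1)

lemma dom_set_mult: "x \<in> dom_set \<Longrightarrow> y \<in> dom_set \<Longrightarrow> x * y \<in> dom_set"
  unfolding dom_set_def by (auto simp flip: to_fract_mult)

lemma subspace_dom_set: "fract.subspace dom_set"
proof (rule fract.subspaceI)
  show "0 \<in> dom_set" by (metis dom_setI to_fract_0)
  show "x + y \<in> dom_set" if "x \<in> dom_set" "y \<in> dom_set" for x y :: "'a fract"
    using that unfolding dom_set_def by (auto simp flip: to_fract_add)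
  show "fscale c x \<in> dom_set" if "x \<in> dom_set" for c and x :: "'a fract"
    using that by (simp add: fscale_def dom_set_mult dom_setI)
qed

lemma subspace_mult:
  assumes "fract.subspace E" "d \<in> dom_set" "x \<in> E"
  shows "d * x \<in> E" "x * d \<in> E"
  using assms fract.subspace_scale[of E x] unfolding dom_set_def fscale_def
  by (auto simp: mult.commute)

lemma subspace_dom_setI:
  assumes "0 \<in> E" "\<And>x y. x \<in> E \<Longrightarrow> y \<in> E \<Longrightarrow> x + y \<in> E"
    and "\<And>d x. d \<in> dom_set \<Longrightarrow> x \<in> E \<Longrightarrow> d * x \<in> E"
  shows "fract.subspace E"
  by (rule fract.subspaceI) (auto simp: fscale_def intro: assms dom_setI)

lemma subspace_scaled_vimage:
  assumes "fract.subspace E"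
  shows "fract.subspace {y. x * y \<in> E}"
proof (rule subspace_dom_setI)
  show "d * y \<in> {y. x * y \<in> E}" if "d \<in> dom_set" "y \<in> {y. x * y \<in> E}" for d y
    using subspace_mult(1)[OF assms that(1), of "x * y"] that(2)
    by (simp add: mult.left_commute)
qed (use assms in \<open>auto simp: algebra_simps fract.subspace_0 fract.subspace_add\<close>)

lemma subspace_scaled_image:
  assumes "fract.subspace E"
  shows "fract.subspace ((*) x ` E)"
proof (rule subspace_dom_setI)
  show "0 \<in> (*) x ` E"
    using fract.subspace_0[OF assms] by (intro image_eqI[of _ _ 0]) auto
  show "u + v \<in> (*) x ` E" if "u \<in> (*) x ` E" "v \<in> (*) x ` E" for u v
    using that fract.subspace_add[OF assms] by (auto simp flip: distrib_left)
  show "d * u \<in> (*) x ` E" if "d \<in> dom_set" "u \<in> (*) x ` E" for d u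
    using that subspace_mult(1)[OF assms] by (auto simp: mult.left_commute)
qed

lemma scaled_span: "(*) x ` fract.span S = fract.span ((*) x ` S)"
proof
  have "fract.span S \<subseteq> {y. x * y \<in> fract.span ((*) x ` S)}"
    by (intro fract.span_minimal subspace_scaled_vimage) (auto intro: fract.span_base)
  then show "(*) x ` fract.span S \<subseteq> fract.span ((*) x ` S)" by auto
  show "fract.span ((*) x ` S) \<subseteq> (*) x ` fract.span S"
    by (intro fract.span_minimal subspace_scaled_image) (auto intro: fract.span_base)
qed

lemma span_singleton: "fract.span {x} = (*) x ` dom_set"
proof
  show "fract.span {x} \<subseteq> (*) x ` dom_set"
  proof (rule fract.span_minimal)
    show "{x} \<subseteq> (*) x ` dom_set" using imageI[OF one_in_dom_set, of "(*) x"] by simp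
  qed (rule subspace_scaled_image[OF subspace_dom_set])
  show "(*) x ` dom_set \<subseteq> fract.span {x}"
    using subspace_mult(2)[OF fract.subspace_span _ fract.span_base[of x "{x}"]] by auto
qed

lemma FbarI: "fract.subspace E \<Longrightarrow> x \<in> E \<Longrightarrow> x \<noteq> 0 \<Longrightarrow> E \<in> Fbar"
  by (auto simp: Fbar_def)

lemma Fbar_subspace: "E \<in> Fbar \<Longrightarrow> fract.subspace E"
  by (simp add: Fbar_def)

lemma Fbar_nonzero:
  assumes "E \<in> Fbar"
  obtains x where "x \<in> E" "x \<noteq> 0"
  using assms fract.subspace_0[of E] unfolding Fbar_def by blast

lemma Fbar_superspace: "E \<in> Fbar \<Longrightarrow> E \<subseteq> F \<Longrightarrow> fract.subspace F \<Longrightarrow> F \<in> Fbar"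
  by (blast elim: Fbar_nonzero intro: FbarI)

lemma Fbar_scaled:
  assumes "E \<in> Fbar" "x \<noteq> 0"
  shows "(*) x ` E \<in> Fbar"
proof -
  obtain y where "y \<in> E" "y \<noteq> 0" using assms(1) by (rule Fbar_nonzero)
  then have "x * y \<in> (*) x ` E" "x * y \<noteq> 0" using assms(2) by auto
  then show ?thesis
    by (rule FbarI[OF subspace_scaled_image[OF Fbar_subspace[OF assms(1)]]])
qed

lemma dom_set_Fbar: "dom_set \<in> Fbar"
  using FbarI[OF subspace_dom_set one_in_dom_set] by simp

lemma principal_Fbar: "x \<noteq> 0 \<Longrightarrow> fract.span {x} \<in> Fbar"
  by (rule FbarI[of _ x]) (auto intro: fract.span_base)

lemma subspace_eq_dom_set:
  assumes "fract.subspace I" "I \<subseteq> dom_set" "1 \<in> I"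
  shows "I = dom_set"
proof
  show "dom_set \<subseteq> I"
  proof
    show "d \<in> I" if "d \<in> dom_set" for d
      using subspace_mult(1)[OF assms(1) that assms(3)] by simp
  qed
qed (rule assms(2))

text \<open>This turns invertibility of a fractional ideal into a question about integral ideals.\<close>

lemma nz_ideal_inverse_product:
  assumes "nz_fractional_ideal I"
  shows "nz_ideal (mod_mult I (colon dom_set I))"
proof -
  from assms obtain d where I: "I \<in> Fbar" and d: "d \<noteq> 0" "fscale d ` I \<subseteq> dom_set"
    by (auto simp: nz_fractional_ideal_def)
  obtain x where x: "x \<in> I" "x \<noteq> 0" using I by (rule Fbar_nonzero)
  \<comment> \<open>The denominator \<open>d\<close> lies in \<open>I\<^sup>-\<^sup>1\<close>, which keeps the product from vanishing.\<close>
  have "to_fract d \<in> colon dom_set I"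
    using d(2) by (auto simp: colon_def fscale_def)
  then have "x * to_fract d \<in> mod_mult I (colon dom_set I)"
    unfolding mod_mult_def using x(1) by (intro fract.span_base) blast
  then have "mod_mult I (colon dom_set I) \<in> Fbar"
    using x(2) d(1) by (intro FbarI[of _ "x * to_fract d"]) (auto simp: mod_mult_def)
  moreover have "mod_mult I (colon dom_set I) \<subseteq> dom_set"
    unfolding mod_mult_def
    by (intro fract.span_minimal subspace_dom_set) (auto simp: colon_def mult.commute)
  ultimately show ?thesis by (simp add: nz_ideal_def)
qed

lemma nz_ideal_fractional: "nz_ideal I \<Longrightarrow> nz_fractional_ideal I"
  unfolding nz_fractional_ideal_def nz_ideal_def
  by (intro conjI exI[of _ 1]) (auto simp: fscale_def)

section \<open>Localization at a prime\<close>

text \<open>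
  Every element of \<open>Q D\<^sub>Q\<close> is a fraction \<open>m / s\<close> with \<open>m \<in> Q\<close>, \<open>s \<notin> Q\<close>; if it equals some
  \<open>d \<in> D\<close>, then \<open>d s = m \<in> Q\<close> and primality puts \<open>d\<close> into \<open>Q\<close>.
\<close>

lemma prime_localization_contract:
  fixes Q :: "'a::idom fract set"
  assumes Q: "fract.subspace Q" "Q \<subseteq> dom_set" "1 \<notin> Q"
    and prime: "\<And>a b. a \<in> dom_set \<Longrightarrow> b \<in> dom_set \<Longrightarrow> a * b \<in> Q \<Longrightarrow> a \<in> Q \<or> b \<in> Q"
  shows "mod_mult Q (localization Q) \<inter> dom_set \<subseteq> Q"
proof -
  let ?L = "{m / s | m s. m \<in> Q \<and> s \<in> dom_set - Q}"
  have nz: "s \<noteq> 0" if "s \<in> dom_set - Q" for s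
    using that fract.subspace_0[OF Q(1)] by auto
  have "fract.subspace ?L"
  proof (rule subspace_dom_setI)
    show "0 \<in> ?L"
      using fract.subspace_0[OF Q(1)] one_in_dom_set Q(3)
      by (intro CollectI exI[of _ 0] exI[of _ 1]) simp
  next
    fix x y assume "x \<in> ?L" "y \<in> ?L"
    then obtain m s n t where
      x: "x = m / s" "m \<in> Q" "s \<in> dom_set - Q" and y: "y = n / t" "n \<in> Q" "t \<in> dom_set - Q"
      by blast
    have "x + y = (m * t + n * s) / (s * t)"
      using nz[OF x(3)] nz[OF y(3)] by (simp add: x y add_frac_eq)
    moreover have "m * t + n * s \<in> Q"
      using x y by (auto intro!: fract.subspace_add[OF Q(1)] subspace_mult(2)[OF Q(1)])
    moreover have "s * t \<in> dom_set - Q" using x y prime dom_set_mult by blast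
    ultimately show "x + y \<in> ?L" by blast
  next
    fix d x :: "'a fract" assume d: "d \<in> dom_set" and "x \<in> ?L"
    then obtain m s where x: "x = m / s" "m \<in> Q" "s \<in> dom_set - Q" by blast
    have "d * x = (d * m) / s" by (simp add: x)
    moreover have "d * m \<in> Q" using subspace_mult(1)[OF Q(1) d x(2)] .
    ultimately show "d * x \<in> ?L" using x by blast
  qed
  moreover have "{x * y | x y. x \<in> Q \<and> y \<in> localization Q} \<subseteq> ?L"
  proof clarify
    fix x y assume x: "x \<in> Q" and "y \<in> localization Q"
    then obtain a s where y: "y = a / s" "a \<in> dom_set" "s \<in> dom_set - Q"
      by (auto simp: localization_def)
    have "x * y = (x * a) / s" by (simp add: y)
    moreover have "x * a \<in> Q" using subspace_mult(2)[OF Q(1) y(2) x] .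
    ultimately show "\<exists>m s. x * y = m / s \<and> m \<in> Q \<and> s \<in> dom_set - Q" using y by blast
  qed
  ultimately have le: "mod_mult Q (localization Q) \<subseteq> ?L"
    unfolding mod_mult_def by (intro fract.span_minimal)
  show ?thesis
  proof clarify
    fix d assume "d \<in> mod_mult Q (localization Q)" and d: "d \<in> dom_set"
    then obtain m s where ms: "d = m / s" "m \<in> Q" "s \<in> dom_set - Q" using le by blast
    then have "d * s \<in> Q" using nz by simp
    then show "d \<in> Q" using prime[OF d] ms by blast
  qed
qed

lemma subset_mod_mult_localization:
  assumes "1 \<notin> Q"
  shows "E \<subseteq> mod_mult E (localization Q)"
proof
  fix x assume x: "x \<in> E"
  have "1 \<in> localization Q"
    using assms one_in_dom_set unfolding localization_def
    by (intro CollectI exI[of _ 1]) simp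
  then have "x * 1 \<in> mod_mult E (localization Q)"
    unfolding mod_mult_def using x by (intro fract.span_base) blast
  then show "x \<in> mod_mult E (localization Q)" by simp
qed

lemma one_in_mod_mult_localization:
  assumes I: "fract.subspace I" "I \<subseteq> dom_set" "\<not> I \<subseteq> Q" and Q0: "0 \<in> Q"
  shows "1 \<in> mod_mult I (localization Q)"
proof -
  obtain s where s: "s \<in> I" "s \<notin> Q" using I by blast
  then have s': "s \<in> dom_set - Q" "s \<noteq> 0" using I Q0 by auto
  then have "1 / s \<in> localization Q" using one_in_dom_set unfolding localization_def by blast
  then have "s * (1 / s) \<in> mod_mult I (localization Q)"
    unfolding mod_mult_def using s by (intro fract.span_base) blast
  then show ?thesis using s' by simp
qed

section \<open>Density of ideals\<close>

locale semistar_operation =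
  fixes st :: "'a::idom fract set \<Rightarrow> 'a fract set"
  assumes semistar: "semistar st"
begin

lemma closed: "E \<in> Fbar \<Longrightarrow> st E \<in> Fbar"
  and scale: "E \<in> Fbar \<Longrightarrow> x \<noteq> 0 \<Longrightarrow> st ((*) x ` E) = (*) x ` st E"
  and mono: "E \<in> Fbar \<Longrightarrow> F \<in> Fbar \<Longrightarrow> E \<subseteq> F \<Longrightarrow> st E \<subseteq> st F"
  and extensive: "E \<in> Fbar \<Longrightarrow> E \<subseteq> st E"
  and idem: "E \<in> Fbar \<Longrightarrow> st (st E) = st E"
  using semistar by (simp_all add: semistar_def)

lemma closure_least: "E \<in> Fbar \<Longrightarrow> F \<in> Fbar \<Longrightarrow> E \<subseteq> st F \<Longrightarrow> st E \<subseteq> st F"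
  by (metis mono closed idem)

lemma one_in_closure_dom: "1 \<in> st dom_set"
  using extensive[OF dom_set_Fbar] one_in_dom_set by blast

lemma dom_closure_le:
  assumes "E \<in> Fbar" "1 \<in> st E"
  shows "st dom_set \<subseteq> st E"
proof (rule closure_least[OF dom_set_Fbar assms(1)])
  show "dom_set \<subseteq> st E"
  proof
    show "d \<in> st E" if "d \<in> dom_set" for d
      using subspace_mult(1)[OF Fbar_subspace[OF closed[OF assms(1)]] that assms(2)] by simp
  qed
qed

lemma closure_eq_dom_iff:
  assumes "nz_ideal I"
  shows "st I = st dom_set \<longleftrightarrow> 1 \<in> st I"
proof
  have I: "I \<in> Fbar" "I \<subseteq> dom_set" using assms by (auto simp: nz_ideal_def)
  show "st I = st dom_set" if "1 \<in> st I"
    using dom_closure_le[OF I(1) that] mono[OF I(1) dom_set_Fbar I(2)] by blast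
qed (use one_in_closure_dom in simp)

lemma invertible_iff_dense:
  assumes "nz_fractional_ideal I"
  shows "star_invertible st I \<longleftrightarrow> 1 \<in> st (mod_mult I (colon dom_set I))"
  unfolding star_invertible_def
  by (rule closure_eq_dom_iff[OF nz_ideal_inverse_product[OF assms]])

lemma quasi_star_ideal_closure:
  assumes "nz_ideal I"
  shows "quasi_star_ideal st (st I \<inter> dom_set)" and "I \<subseteq> st I \<inter> dom_set"
proof -
  have I: "I \<in> Fbar" "I \<subseteq> dom_set" using assms by (auto simp: nz_ideal_def)
  show sub: "I \<subseteq> st I \<inter> dom_set" using I extensive by blast
  have F: "st I \<inter> dom_set \<in> Fbar"
    by (rule Fbar_superspace[OF I(1) sub])
       (simp add: fract.subspace_inter Fbar_subspace closed I subspace_dom_set)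
  have "st (st I \<inter> dom_set) \<subseteq> st I" by (rule closure_least[OF F I(1)]) auto
  moreover have "st I \<subseteq> st (st I \<inter> dom_set)" by (rule mono[OF I(1) F sub])
  ultimately show "quasi_star_ideal st (st I \<inter> dom_set)"
    using F by (auto simp: quasi_star_ideal_def nz_ideal_def)
qed

lemma proper_quasi_star_ideal_iff:
  assumes "quasi_star_ideal st I"
  shows "I \<noteq> dom_set \<longleftrightarrow> 1 \<notin> st I"
  using assms subspace_eq_dom_set[of I] one_in_dom_set one_in_closure_dom
  by (auto simp: quasi_star_ideal_def nz_ideal_def Fbar_def)

text \<open>
  If \<open>a\<close> lies outside the maximal ideal \<open>M\<close>, then \<open>M + aD\<close> is dense. Multiplying
  \<open>1 \<in> (M + aD)\<^sup>\<star>\<close> by \<open>b\<close> gives \<open>b \<in> (bM + abD)\<^sup>\<star> \<subseteq> M\<^sup>\<star>\<close>, and \<open>M\<close> is a quasi-\<open>\<star>\<close>-ideal.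
\<close>

lemma quasi_star_max_prime:
  assumes M: "M \<in> quasi_star_max st" and a: "a \<in> dom_set" and b: "b \<in> dom_set"
    and ab: "a * b \<in> M"
  shows "a \<in> M \<or> b \<in> M"
proof (rule disjCI)
  assume nb: "b \<notin> M"
  have MF: "M \<in> Fbar" and MD: "M \<subseteq> dom_set"
    and Mcl: "st M \<inter> dom_set = M"
    using M by (auto simp: quasi_star_max_def quasi_star_ideal_def nz_ideal_def)
  have Ms: "fract.subspace M" using MF by (rule Fbar_subspace)
  have b0: "b \<noteq> 0" using nb fract.subspace_0[OF Ms] by auto
  define N where "N = fract.span (insert a M)"
  have MN: "insert a M \<subseteq> N" unfolding N_def by (rule fract.span_superset)
  have NF: "N \<in> Fbar" by (rule Fbar_superspace[OF MF]) (use MN in \<open>auto simp: N_def\<close>)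
  have ND: "N \<subseteq> dom_set"
    unfolding N_def by (rule fract.span_minimal) (use a MD in \<open>auto simp: subspace_dom_set\<close>)
  have nzN: "nz_ideal N" using NF ND by (simp add: nz_ideal_def)
  have "N \<subseteq> {y. b * y \<in> M}"
    unfolding N_def
    by (intro fract.span_minimal subspace_scaled_vimage Ms)
       (use ab subspace_mult(1)[OF Ms b] in \<open>auto simp: mult.commute\<close>)
  then have bN: "(*) b ` N \<subseteq> M" by auto
  have "st ((*) b ` N) \<subseteq> st M"
    by (rule mono[OF Fbar_scaled[OF NF b0] MF bN])
  then have bst: "(*) b ` st N \<subseteq> st M" using scale[OF NF b0] by simp
  have "1 \<notin> st N"
  proof
    assume "1 \<in> st N"
    then have "b * 1 \<in> st M" using bst by blast
    then show False using Mcl b nb by auto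
  qed
  then have "st N \<inter> dom_set \<noteq> dom_set" using one_in_dom_set by blast
  moreover have "M \<subseteq> st N \<inter> dom_set"
    using quasi_star_ideal_closure(2)[OF nzN] MN by blast
  ultimately have "st N \<inter> dom_set = M"
    using M quasi_star_ideal_closure(1)[OF nzN] unfolding quasi_star_max_def by blast
  then show "a \<in> M" using quasi_star_ideal_closure(2)[OF nzN] MN by blast
qed

section \<open>The associated operation of finite type\<close>

lemma star_fI: "F \<in> Fbar \<Longrightarrow> fin_gen F \<Longrightarrow> F \<subseteq> E \<Longrightarrow> x \<in> st F \<Longrightarrow> x \<in> star_f st E"
  unfolding star_f_def by blast

lemma star_fE:
  assumes "x \<in> star_f st E"
  obtains F where "F \<in> Fbar" "fin_gen F" "F \<subseteq> E" "x \<in> st F"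
  using assms unfolding star_f_def by blast

lemma star_f_mono: "E \<subseteq> F \<Longrightarrow> star_f st E \<subseteq> star_f st F"
  unfolding star_f_def by blast

lemma star_f_le:
  assumes "E \<in> Fbar"
  shows "star_f st E \<subseteq> st E"
proof
  fix x assume "x \<in> star_f st E"
  then obtain F where "F \<in> Fbar" "F \<subseteq> E" "x \<in> st F" by (rule star_fE)
  then show "x \<in> st E" using mono[OF _ assms] by auto
qed

lemma principal_closure:
  assumes "x \<noteq> 0"
  shows "st (fract.span {x}) = (*) x ` st dom_set"
  unfolding span_singleton by (rule scale[OF dom_set_Fbar assms])

lemma star_f_extensive:
  assumes "E \<in> Fbar"
  shows "E \<subseteq> star_f st E"
proof -
  have nz: "y \<in> star_f st E" if y: "y \<in> E" "y \<noteq> 0" for y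
  proof (rule star_fI)
    show "fract.span {y} \<in> Fbar" by (rule principal_Fbar[OF y(2)])
    show "fin_gen (fract.span {y})" unfolding fin_gen_def by blast
    show "fract.span {y} \<subseteq> E"
      by (rule fract.span_minimal) (use y assms in \<open>auto simp: Fbar_subspace\<close>)
    show "y \<in> st (fract.span {y})"
      using extensive[OF principal_Fbar[OF y(2)]] by (auto intro: fract.span_base)
  qed
  obtain x where x: "x \<in> E" "x \<noteq> 0" using assms by (rule Fbar_nonzero)
  \<comment> \<open>The zero submodule is no admissible generator, so \<open>0\<close> is reached through any \<open>x \<noteq> 0\<close>.\<close>
  have "0 \<in> star_f st E"
  proof -
    obtain F where F: "F \<in> Fbar" "fin_gen F" "F \<subseteq> E" using nz[OF x] by (rule star_fE)
    then show ?thesis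
      by (intro star_fI[of F]) (auto simp: fract.subspace_0 Fbar_subspace closed)
  qed
  then show ?thesis using nz by (metis subsetI)
qed

lemma fin_gen_directed:
  assumes "F \<in> Fbar" "fin_gen F" "F \<subseteq> E" "G \<in> Fbar" "fin_gen G" "G \<subseteq> E"
    and "fract.subspace E"
  obtains H where "H \<in> Fbar" "fin_gen H" "H \<subseteq> E" "F \<subseteq> H" "G \<subseteq> H"
proof -
  obtain S T where ST: "finite S" "F = fract.span S" "finite T" "G = fract.span T"
    using assms by (auto simp: fin_gen_def)
  let ?H = "fract.span (S \<union> T)"
  have sub: "F \<subseteq> ?H" "G \<subseteq> ?H" unfolding ST(2,4) by (rule fract.span_mono, blast)+
  have gens: "S \<subseteq> E" "T \<subseteq> E"
    using assms(3,6) fract.span_superset[of S] fract.span_superset[of T] ST by auto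
  show thesis
  proof (rule that)
    show "?H \<in> Fbar" by (rule Fbar_superspace[OF assms(1) sub(1)]) simp
    show "fin_gen ?H" unfolding fin_gen_def using ST by blast
    show "?H \<subseteq> E" by (rule fract.span_minimal) (use gens assms(7) in auto)
  qed (rule sub)+
qed

text \<open>
  Finitely many elements of \<open>E\<^bsup>\<star>f\<^esup>\<close> have a common finitely generated witness; idempotence of
  \<open>\<star>\<^sub>f\<close> comes down to this.
\<close>

lemma finite_subset_star_f:
  assumes "E \<in> Fbar" "finite S" "S \<subseteq> star_f st E"
  obtains G where "G \<in> Fbar" "fin_gen G" "G \<subseteq> E" "S \<subseteq> st G"
proof -
  have "\<exists>G. G \<in> Fbar \<and> fin_gen G \<and> G \<subseteq> E \<and> S \<subseteq> st G"
    using assms(2,3)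
  proof (induction S)
    case empty
    obtain x where "x \<in> E" using assms(1) by (rule Fbar_nonzero)
    then have "x \<in> star_f st E" using star_f_extensive[OF assms(1)] by blast
    then obtain G where "G \<in> Fbar" "fin_gen G" "G \<subseteq> E" by (rule star_fE)
    then show ?case by (intro exI[of _ G]) simp
  next
    case (insert x S)
    then obtain G where G: "G \<in> Fbar" "fin_gen G" "G \<subseteq> E" "S \<subseteq> st G" by auto
    have "x \<in> star_f st E" using insert.prems by simp
    then obtain F where F: "F \<in> Fbar" "fin_gen F" "F \<subseteq> E" "x \<in> st F" by (rule star_fE)
    obtain H where H: "H \<in> Fbar" "fin_gen H" "H \<subseteq> E" "F \<subseteq> H" "G \<subseteq> H"
      using fin_gen_directed[OF F(1-3) G(1-3) Fbar_subspace[OF assms(1)]] .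
    have "st F \<subseteq> st H" "st G \<subseteq> st H"
      by (rule mono[OF F(1) H(1,4)], rule mono[OF G(1) H(1,5)])
    then have "insert x S \<subseteq> st H" using F(4) G(4) by auto
    then show ?case using H(1-3) by (intro exI[of _ H]) simp
  qed
  then show thesis using that by (elim exE conjE)
qed

lemma star_f_Fbar:
  assumes "E \<in> Fbar"
  shows "star_f st E \<in> Fbar"
proof (rule Fbar_superspace[OF assms star_f_extensive[OF assms]], rule subspace_dom_setI)
  show "0 \<in> star_f st E"
    using star_f_extensive[OF assms] fract.subspace_0[OF Fbar_subspace[OF assms]] by blast
next
  fix x y assume "x \<in> star_f st E" "y \<in> star_f st E"
  then have "{x, y} \<subseteq> star_f st E" by simp
  then obtain G where G: "G \<in> Fbar" "fin_gen G" "G \<subseteq> E" "{x, y} \<subseteq> st G"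
    by (rule finite_subset_star_f[OF assms finite.insertI[OF finite.insertI[OF finite.emptyI]]])
  then have "x + y \<in> st G"
    using fract.subspace_add[OF Fbar_subspace[OF closed[OF G(1)]]] by auto
  then show "x + y \<in> star_f st E" by (rule star_fI[OF G(1-3)])
next
  fix d x :: "'a fract" assume d: "d \<in> dom_set" and x: "x \<in> star_f st E"
  obtain F where F: "F \<in> Fbar" "fin_gen F" "F \<subseteq> E" "x \<in> st F" using x by (rule star_fE)
  show "d * x \<in> star_f st E"
    by (rule star_fI[OF F(1-3) subspace_mult(1)[OF Fbar_subspace[OF closed[OF F(1)]] d F(4)]])
qed

lemma star_f_scaled_le:
  assumes "x \<noteq> 0"
  shows "(*) x ` star_f st E \<subseteq> star_f st ((*) x ` E)"
proof clarify
  fix y assume "y \<in> star_f st E"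
  then obtain F where F: "F \<in> Fbar" "fin_gen F" "F \<subseteq> E" "y \<in> st F" by (rule star_fE)
  show "x * y \<in> star_f st ((*) x ` E)"
  proof (rule star_fI)
    show "(*) x ` F \<in> Fbar" using F assms by (simp add: Fbar_scaled)
    show "fin_gen ((*) x ` F)"
      using F(2) scaled_span[of x] unfolding fin_gen_def by (metis finite_imageI)
    show "(*) x ` F \<subseteq> (*) x ` E" using F(3) by (rule image_mono)
    show "x * y \<in> st ((*) x ` F)" unfolding scale[OF F(1) assms] using F(4) by (rule imageI)
  qed
qed

lemma star_f_scale:
  assumes "x \<noteq> 0"
  shows "star_f st ((*) x ` E) = (*) x ` star_f st E"
proof
  \<comment> \<open>The inclusion for \<open>x\<^sup>-\<^sup>1\<close> and \<open>xE\<close> is the missing one, multiplied by \<open>x\<^sup>-\<^sup>1\<close>.\<close>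
  have "(*) (inverse x) ` star_f st ((*) x ` E) \<subseteq> star_f st ((*) (inverse x) ` (*) x ` E)"
    using assms by (intro star_f_scaled_le) simp
  also have "(*) (inverse x) ` (*) x ` E = E"
    using assms by (simp add: image_image flip: mult.assoc)
  finally have "(*) x ` (*) (inverse x) ` star_f st ((*) x ` E) \<subseteq> (*) x ` star_f st E"
    by (rule image_mono)
  then show "star_f st ((*) x ` E) \<subseteq> (*) x ` star_f st E"
    using assms by (simp add: image_image flip: mult.assoc)
qed (rule star_f_scaled_le[OF assms])

lemma star_f_idem:
  assumes "E \<in> Fbar"
  shows "star_f st (star_f st E) = star_f st E"
proof
  show "star_f st (star_f st E) \<subseteq> star_f st E"
  proof
    fix x assume "x \<in> star_f st (star_f st E)"
    then obtain F where F: "F \<in> Fbar" "fin_gen F" "F \<subseteq> star_f st E" "x \<in> st F"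
      by (rule star_fE)
    then obtain S where S: "finite S" "F = fract.span S" by (auto simp: fin_gen_def)
    have "S \<subseteq> star_f st E" using F(3) S(2) fract.span_superset[of S] by blast
    then obtain G where G: "G \<in> Fbar" "fin_gen G" "G \<subseteq> E" "S \<subseteq> st G"
      by (rule finite_subset_star_f[OF assms S(1)])
    have "F \<subseteq> st G" unfolding S(2)
      by (rule fract.span_minimal) (use G in \<open>auto simp: Fbar_subspace closed\<close>)
    then have "x \<in> st G" using closure_least[OF F(1) G(1)] F(4) by blast
    then show "x \<in> star_f st E" by (rule star_fI[OF G(1-3)])
  qed
qed (rule star_f_extensive[OF star_f_Fbar[OF assms]])

lemma semistar_star_f: "semistar (star_f st)"
  unfolding semistar_def
  by (simp add: star_f_Fbar star_f_scale star_f_mono star_f_extensive star_f_idem)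

interpretation ft: semistar_operation "star_f st"
  by standard (rule semistar_star_f)

lemma H_domain_iff_dense:
  "H_domain st \<longleftrightarrow> (\<forall>I. nz_ideal I \<longrightarrow> 1 \<in> st I \<longrightarrow> 1 \<in> star_f st I)"
proof (intro iffI allI impI)
  fix I assume H: "H_domain st" and I: "nz_ideal I" "1 \<in> st I"
  then obtain J where J: "nz_ideal J" "fin_gen J" "J \<subseteq> I" "st J = st dom_set"
    unfolding H_domain_def using closure_eq_dom_iff by blast
  then show "1 \<in> star_f st I"
    using one_in_closure_dom by (intro star_fI[of J]) (auto simp: nz_ideal_def)
next
  assume R: "\<forall>I. nz_ideal I \<longrightarrow> 1 \<in> st I \<longrightarrow> 1 \<in> star_f st I"
  show "H_domain st"
    unfolding H_domain_def
  proof (intro allI impI, elim conjE)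
    fix I assume I: "nz_ideal I" "st I = st dom_set"
    then have "1 \<in> star_f st I" using R one_in_closure_dom by simp
    then obtain F where F: "F \<in> Fbar" "fin_gen F" "F \<subseteq> I" "1 \<in> st F" by (rule star_fE)
    then have "nz_ideal F" using I by (auto simp: nz_ideal_def)
    then show "\<exists>J. nz_ideal J \<and> fin_gen J \<and> J \<subseteq> I \<and> st J = st dom_set"
      using F closure_eq_dom_iff by blast
  qed
qed

section \<open>Invertibility\<close>

text \<open>
  If \<open>z I \<subseteq> D\<close> then \<open>z I\<^sup>\<star> \<subseteq> D\<^sup>\<star>\<close>, and \<open>1 \<in> I\<^sup>\<star>\<close> leaves \<open>z \<in> D\<^sup>\<star>\<close>. A generator \<open>xz\<close> of
  \<open>I I\<^sup>-\<^sup>1\<close> therefore lies in \<open>x D\<^sup>\<star> = (xD)\<^sup>\<star>\<close>, the closure of a finitely generated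
  submodule of \<open>I\<close>.
\<close>

lemma dense_inverse_product:
  assumes I: "nz_ideal I" and dense: "1 \<in> st I"
  shows "mod_mult I (colon dom_set I) \<subseteq> star_f st I"
proof -
  have IF: "I \<in> Fbar" using I by (simp add: nz_ideal_def)
  have SF: "fract.subspace (star_f st I)" by (intro Fbar_subspace star_f_Fbar IF)
  have inv: "z \<in> st dom_set" if z: "z \<in> colon dom_set I" for z
  proof (cases "z = 0")
    case True
    then show ?thesis by (simp add: fract.subspace_0 Fbar_subspace closed dom_set_Fbar)
  next
    case False
    have "(*) z ` I \<subseteq> dom_set" using z by (simp add: colon_def)
    then have "st ((*) z ` I) \<subseteq> st dom_set"
      by (rule mono[OF Fbar_scaled[OF IF False] dom_set_Fbar])
    then have "(*) z ` st I \<subseteq> st dom_set" using scale[OF IF False] by simp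
    then have "z * 1 \<in> st dom_set" using dense by blast
    then show ?thesis by simp
  qed
  have gen: "x * z \<in> star_f st I" if x: "x \<in> I" and z: "z \<in> colon dom_set I" for x z
  proof (cases "x = 0")
    case True
    then show ?thesis using fract.subspace_0[OF SF] by simp
  next
    case False
    show ?thesis
    proof (rule star_fI[OF principal_Fbar[OF False]])
      show "fin_gen (fract.span {x})" unfolding fin_gen_def by blast
      show "fract.span {x} \<subseteq> I"
        by (rule fract.span_minimal) (use x IF in \<open>auto simp: Fbar_subspace\<close>)
      show "x * z \<in> st (fract.span {x})"
        unfolding principal_closure[OF False] using inv[OF z] by (rule imageI)
    qed
  qed
  show ?thesis unfolding mod_mult_def by (rule fract.span_minimal) (use gen SF in auto)
qed

lemma H_domain_iff_invertible:
  "H_domain st \<longleftrightarrow>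
     (\<forall>I. nz_fractional_ideal I \<longrightarrow> star_invertible st I = star_invertible (star_f st) I)"
proof (rule iffI, intro allI impI)
  fix I :: "'a fract set" assume H: "H_domain st" and I: "nz_fractional_ideal I"
  let ?P = "mod_mult I (colon dom_set I)"
  have P: "nz_ideal ?P" by (rule nz_ideal_inverse_product[OF I])
  have "1 \<in> st ?P \<longleftrightarrow> 1 \<in> star_f st ?P"
    using H P star_f_le[of ?P] by (auto simp: H_domain_iff_dense nz_ideal_def)
  then show "star_invertible st I = star_invertible (star_f st) I"
    by (simp add: invertible_iff_dense[OF I] ft.invertible_iff_dense[OF I])
next
  assume R: "\<forall>I. nz_fractional_ideal I \<longrightarrow>
    star_invertible st I = star_invertible (star_f st) I"
  show "H_domain st"
    unfolding H_domain_iff_dense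
  proof (intro allI impI)
    fix I assume I: "nz_ideal I" and dense: "1 \<in> st I"
    let ?P = "mod_mult I (colon dom_set I)"
    have frac: "nz_fractional_ideal I" by (rule nz_ideal_fractional[OF I])
    have F: "I \<in> Fbar" "?P \<in> Fbar"
      using I nz_ideal_inverse_product[OF frac] by (auto simp: nz_ideal_def)
    have "I \<subseteq> ?P"
    proof
      fix x assume x: "x \<in> I"
      have "1 \<in> colon dom_set I" using I by (auto simp: colon_def nz_ideal_def)
      then have "x * 1 \<in> ?P" unfolding mod_mult_def using x by (intro fract.span_base) blast
      then show "x \<in> ?P" by simp
    qed
    then have "1 \<in> st ?P" using mono[OF F] dense by blast
    then have "1 \<in> star_f st ?P"
      using R frac by (simp add: invertible_iff_dense ft.invertible_iff_dense)
    moreover have "star_f st ?P \<subseteq> star_f st I"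
      by (rule ft.closure_least[OF F(2,1) dense_inverse_product[OF I dense]])
    ultimately show "1 \<in> star_f st I" by blast
  qed
qed

section \<open>Maximal spectra\<close>

text \<open>
  Finite type is what makes Zorn's lemma applicable: a finitely generated submodule of the
  union of a chain already lies in a member of the chain, so the union of a chain of
  quasi-\<open>\<star>\<^sub>f\<close>-ideals is again one.
\<close>

lemma quasi_star_f_ideal_Union_chain:
  assumes chain: "subset.chain A C" and ne: "C \<noteq> {}"
    and quasi: "\<And>J. J \<in> C \<Longrightarrow> quasi_star_ideal (star_f st) J"
  shows "quasi_star_ideal (star_f st) (\<Union>C)"
proof -
  have sp: "fract.subspace J" and nz: "J \<in> Fbar" and sub: "J \<subseteq> dom_set"
    and cl: "star_f st J \<inter> dom_set = J" if "J \<in> C" for J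
    using quasi[OF that] by (auto simp: quasi_star_ideal_def nz_ideal_def Fbar_def)
  have within: "\<exists>J\<in>C. S \<subseteq> J" if "finite S" "S \<subseteq> \<Union>C" for S
    using finite_subset_Union_chain[OF that ne chain] by blast
  have "fract.subspace (\<Union>C)"
  proof (rule subspace_dom_setI)
    show "0 \<in> \<Union>C" using ne fract.subspace_0[OF sp] by blast
    show "x + y \<in> \<Union>C" if xy: "x \<in> \<Union>C" "y \<in> \<Union>C" for x y
    proof -
      obtain J where "J \<in> C" "{x, y} \<subseteq> J" using within[of "{x, y}"] xy by auto
      then show ?thesis using fract.subspace_add[OF sp, of J x y] by auto
    qed
    show "d * x \<in> \<Union>C" if "d \<in> dom_set" "x \<in> \<Union>C" for d x
      using that subspace_mult(1)[OF sp] by blast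
  qed
  then have UF: "\<Union>C \<in> Fbar"
    using ne nz Fbar_superspace[of _ "\<Union>C"] by blast
  have "star_f st (\<Union>C) \<inter> dom_set \<subseteq> \<Union>C"
  proof clarify
    fix x assume x: "x \<in> star_f st (\<Union>C)" "x \<in> dom_set"
    obtain F where F: "F \<in> Fbar" "fin_gen F" "F \<subseteq> \<Union>C" "x \<in> st F"
      using x(1) by (rule star_fE)
    then obtain S where S: "finite S" "F = fract.span S" by (auto simp: fin_gen_def)
    have "S \<subseteq> \<Union>C" using F(3) S(2) fract.span_superset[of S] by blast
    then obtain J where J: "J \<in> C" "S \<subseteq> J" using within S(1) by blast
    have "F \<subseteq> J" unfolding S(2) by (rule fract.span_minimal[OF J(2) sp[OF J(1)]])
    then have "x \<in> star_f st J" using F by (intro star_fI)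
    then show "x \<in> \<Union>C" using cl[OF J(1)] x(2) J(1) by blast
  qed
  moreover have "\<Union>C \<subseteq> dom_set" using sub by blast
  ultimately show ?thesis
    using star_f_extensive[OF UF] UF by (auto simp: quasi_star_ideal_def nz_ideal_def)
qed

lemma exists_quasi_star_f_max:
  assumes I: "nz_ideal I" and not_dense: "1 \<notin> star_f st I"
  obtains M where "M \<in> quasi_star_max (star_f st)" "I \<subseteq> M"
proof -
  define I' where "I' = star_f st I \<inter> dom_set"
  define A where "A = {J. quasi_star_ideal (star_f st) J \<and> 1 \<notin> J \<and> I' \<subseteq> J}"
  have proper: "J \<noteq> dom_set \<longleftrightarrow> 1 \<notin> J" if "quasi_star_ideal (star_f st) J" for J
    using that one_in_dom_set subspace_eq_dom_set[of J]
    by (auto simp: quasi_star_ideal_def nz_ideal_def Fbar_def)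
  have I'A: "I' \<in> A"
    using ft.quasi_star_ideal_closure(1)[OF I] not_dense by (auto simp: A_def I'_def)
  have "\<exists>M\<in>A. \<forall>J\<in>A. M \<subseteq> J \<longrightarrow> J = M"
  proof (rule subset_Zorn_nonempty)
    show "A \<noteq> {}" using I'A by blast
    fix C assume C: "C \<noteq> {}" "subset.chain A C"
    then have CA: "C \<subseteq> A" by (simp add: subset.chain_def)
    have "quasi_star_ideal (star_f st) (\<Union>C)"
      by (rule quasi_star_f_ideal_Union_chain[OF C(2,1)]) (use CA in \<open>auto simp: A_def\<close>)
    then show "\<Union>C \<in> A" using CA C(1) by (auto simp: A_def)
  qed
  then obtain M where M: "M \<in> A" "\<And>J. J \<in> A \<Longrightarrow> M \<subseteq> J \<Longrightarrow> J = M" by blast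
  have "M \<in> quasi_star_max (star_f st)"
    unfolding quasi_star_max_def mem_Collect_eq
  proof (intro conjI allI impI)
    show "quasi_star_ideal (star_f st) M" "M \<noteq> dom_set"
      using M(1) proper by (auto simp: A_def)
    show "J = M" if "quasi_star_ideal (star_f st) J \<and> J \<noteq> dom_set \<and> M \<subseteq> J" for J
      by (rule M(2)) (use that M(1) proper in \<open>auto simp: A_def\<close>)
  qed
  moreover have "I \<subseteq> M"
    using M(1) ft.quasi_star_ideal_closure(2)[OF I] by (auto simp: A_def I'_def)
  ultimately show thesis by (rule that)
qed

lemma quasi_star_f_ideal:
  assumes "quasi_star_ideal st I"
  shows "quasi_star_ideal (star_f st) I"
  using assms star_f_le[of I] star_f_extensive[of I]
  by (auto simp: quasi_star_ideal_def nz_ideal_def)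

text \<open>
  Under the \<open>H(\<star>)\<close>-property the \<open>\<star>\<close>-closure of \<open>M \<in> \<M>(\<star>\<^sub>f)\<close> in \<open>D\<close> is still proper, hence equal
  to \<open>M\<close> by maximality; so \<open>\<M>(\<star>\<^sub>f) \<subseteq> \<M>(\<star>)\<close>, and Zorn's lemma gives the other inclusion.
  Conversely, a \<open>\<star>\<close>-dense ideal lies in no proper quasi-\<open>\<star>\<close>-ideal, hence in no member of
  \<open>\<M>(\<star>\<^sub>f) = \<M>(\<star>)\<close>, and is therefore \<open>\<star>\<^sub>f\<close>-dense.
\<close>

lemma H_domain_iff_quasi_star_max:
  "H_domain st \<longleftrightarrow> quasi_star_max (star_f st) = quasi_star_max st"
proof
  assume "H_domain st"
  then have H: "\<And>I. nz_ideal I \<Longrightarrow> 1 \<in> st I \<Longrightarrow> 1 \<in> star_f st I"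
    by (simp add: H_domain_iff_dense)
  have le: "quasi_star_max (star_f st) \<subseteq> quasi_star_max st"
  proof
    fix M assume M: "M \<in> quasi_star_max (star_f st)"
    then have nzM: "nz_ideal M" and pM: "M \<noteq> dom_set"
      and qM: "quasi_star_ideal (star_f st) M"
      and mx: "\<And>J. quasi_star_ideal (star_f st) J \<Longrightarrow> J \<noteq> dom_set \<Longrightarrow> M \<subseteq> J \<Longrightarrow> J = M"
      by (auto simp: quasi_star_max_def quasi_star_ideal_def)
    have "1 \<notin> star_f st M" using ft.proper_quasi_star_ideal_iff[OF qM] pM by simp
    then have "1 \<notin> st M" using H nzM by blast
    then have "st M \<inter> dom_set \<noteq> dom_set" using one_in_dom_set by blast
    then have "st M \<inter> dom_set = M"
      using mx quasi_star_f_ideal quasi_star_ideal_closure[OF nzM] by blast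
    then have "quasi_star_ideal st M" using nzM by (simp add: quasi_star_ideal_def)
    then show "M \<in> quasi_star_max st"
      using pM mx quasi_star_f_ideal by (auto simp: quasi_star_max_def)
  qed
  moreover have "quasi_star_max st \<subseteq> quasi_star_max (star_f st)"
  proof
    fix M assume M: "M \<in> quasi_star_max st"
    then have qM: "quasi_star_ideal (star_f st) M" and pM: "M \<noteq> dom_set"
      by (auto simp: quasi_star_max_def quasi_star_f_ideal)
    have "1 \<notin> star_f st M" using ft.proper_quasi_star_ideal_iff[OF qM] pM by simp
    then obtain N where N: "N \<in> quasi_star_max (star_f st)" "M \<subseteq> N"
      using exists_quasi_star_f_max qM unfolding quasi_star_ideal_def by blast
    then have "N = M" using le M by (auto simp: quasi_star_max_def)
    then show "M \<in> quasi_star_max (star_f st)" using N by simp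
  qed
  ultimately show "quasi_star_max (star_f st) = quasi_star_max st" by blast
next
  assume eq: "quasi_star_max (star_f st) = quasi_star_max st"
  show "H_domain st"
    unfolding H_domain_iff_dense
  proof (intro allI impI, rule ccontr)
    fix I assume I: "nz_ideal I" "1 \<in> st I" and "1 \<notin> star_f st I"
    then obtain M where M: "M \<in> quasi_star_max st" "I \<subseteq> M"
      using exists_quasi_star_f_max eq by metis
    then have q: "quasi_star_ideal st M" "M \<noteq> dom_set" by (auto simp: quasi_star_max_def)
    then have "1 \<notin> st M" using proper_quasi_star_ideal_iff by blast
    moreover have "st I \<subseteq> st M"
      by (rule mono) (use I q M in \<open>auto simp: quasi_star_ideal_def nz_ideal_def\<close>)
    ultimately show False using I(2) by blast
  qed
qed

section \<open>The spectral operation\<close>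

text \<open>
  Each \<open>Q \<in> \<M>(\<star>\<^sub>f)\<close> is a proper quasi-\<open>\<star>~\<close>-ideal because \<open>Q D\<^sub>Q \<inter> D = Q\<close>, and a proper
  quasi-\<open>\<star>~\<close>-ideal lies below some such \<open>Q\<close>, since otherwise it would contain a unit of every
  \<open>D\<^sub>Q\<close>. As no member of \<open>\<M>(\<star>\<^sub>f)\<close> contains another, these are exactly the maximal proper
  quasi-\<open>\<star>~\<close>-ideals.
\<close>

lemma quasi_star_max_star_tilde:
  "quasi_star_max (star_tilde st) = quasi_star_max (star_f st)"
proof -
  let ?M = "quasi_star_max (star_f st)"
  have MD: "fract.subspace Q" "Q \<subseteq> dom_set" "1 \<notin> Q" "nz_ideal Q" "Q \<noteq> dom_set"
    if "Q \<in> ?M" for Q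
    using that subspace_eq_dom_set[of Q]
    by (auto simp: quasi_star_max_def quasi_star_ideal_def nz_ideal_def Fbar_def)
  have anti: "R = Q" if "Q \<in> ?M" "R \<in> ?M" "Q \<subseteq> R" for Q R
    using that by (simp add: quasi_star_max_def)
  have ext: "E \<subseteq> star_tilde st E" for E
    unfolding star_tilde_def by (intro INT_greatest subset_mod_mult_localization MD(3))
  have quasi: "quasi_star_ideal (star_tilde st) Q" if Q: "Q \<in> ?M" for Q
  proof -
    have "star_tilde st Q \<inter> dom_set \<subseteq> mod_mult Q (localization Q) \<inter> dom_set"
      unfolding star_tilde_def using Q by (intro Int_mono INT_lower order_refl)
    also have "\<dots> \<subseteq> Q"
      by (rule prime_localization_contract[OF MD(1-3)[OF Q] ft.quasi_star_max_prime[OF Q]])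
    finally show ?thesis
      using ext[of Q] MD(2,4)[OF Q] by (auto simp: quasi_star_ideal_def)
  qed
  have below: "\<exists>Q\<in>?M. I \<subseteq> Q"
    if I: "quasi_star_ideal (star_tilde st) I" "I \<noteq> dom_set" for I
  proof (rule ccontr)
    assume none: "\<not> (\<exists>Q\<in>?M. I \<subseteq> Q)"
    have sI: "fract.subspace I" "I \<subseteq> dom_set" and cl: "star_tilde st I \<inter> dom_set = I"
      using I(1) by (auto simp: quasi_star_ideal_def nz_ideal_def Fbar_def)
    have "1 \<in> star_tilde st I"
      unfolding star_tilde_def
    proof
      fix Q assume Q: "Q \<in> ?M"
      then have "\<not> I \<subseteq> Q" using none by simp
      then show "1 \<in> mod_mult I (localization Q)"
        by (rule one_in_mod_mult_localization[OF sI _ fract.subspace_0[OF MD(1)[OF Q]]])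
    qed
    then have "1 \<in> I" using cl one_in_dom_set by blast
    then show False using subspace_eq_dom_set[OF sI] I(2) by blast
  qed
  show ?thesis
  proof (intro set_eqI iffI)
    fix M assume M: "M \<in> quasi_star_max (star_tilde st)"
    then have qM: "quasi_star_ideal (star_tilde st) M" "M \<noteq> dom_set"
      and mx: "\<And>J. quasi_star_ideal (star_tilde st) J \<Longrightarrow> J \<noteq> dom_set \<Longrightarrow> M \<subseteq> J \<Longrightarrow> J = M"
      by (simp_all add: quasi_star_max_def)
    obtain Q where Q: "Q \<in> ?M" "M \<subseteq> Q" using below[OF qM] by (elim bexE)
    have "Q = M" by (rule mx[OF quasi[OF Q(1)] MD(5)[OF Q(1)] Q(2)])
    then show "M \<in> ?M" using Q(1) by simp
  next
    fix M assume M: "M \<in> ?M"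
    have "J = M" if J: "quasi_star_ideal (star_tilde st) J" "J \<noteq> dom_set" "M \<subseteq> J" for J
    proof -
      obtain Q where Q: "Q \<in> ?M" "J \<subseteq> Q" using below[OF J(1,2)] by (elim bexE)
      have "Q = M" by (rule anti[OF M Q(1) order_trans[OF J(3) Q(2)]])
      then show ?thesis using Q(2) J(3) by simp
    qed
    then show "M \<in> quasi_star_max (star_tilde st)"
      using quasi[OF M] MD(5)[OF M] by (simp add: quasi_star_max_def)
  qed
qed

end

theorem proposition2p8:
  fixes st :: "'a::idom fract set \<Rightarrow> 'a fract set"
  assumes "semistar st"
  shows "(H_domain st \<longleftrightarrow>
            (\<forall>I. nz_fractional_ideal I \<longrightarrow>
               (star_invertible st I \<longleftrightarrow> star_invertible (star_f st) I)))
       \<and> (H_domain st \<longleftrightarrow> quasi_star_max (star_f st) = quasi_star_max st)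
       \<and> (H_domain st \<longleftrightarrow> quasi_star_max (star_tilde st) = quasi_star_max st)"
proof -
  interpret semistar_operation st by standard (rule assms)
  show ?thesis
    using H_domain_iff_invertible H_domain_iff_quasi_star_max quasi_star_max_star_tilde
    by simp
qed

end
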